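(* Let $\Delta x,\Delta y>0$, let $L\ge1$, and let $\omega_1,\dots,\omega_L$ be positive numbers with $\sum_{i=1}^L\omega_i=1$. If $\tilde{\mathbf U}^i,\hat{\mathbf U}^i,\bar{\mathbf U}^i,\breve{\mathbf U}^i\in\mathcal G$, $i=1,\dots,L$, satisfy the 2D "discrete divergence-free" condition $$\frac{\sum_{i=1}^L\omega_i(\tilde B_1^i-\hat B_1^i)}{\Delta x}+\frac{\sum_{i=1}^L\omega_i(\bar B_2^i-\breve B_2^i)}{\Delta y}=0,$$ then for all $\alpha\ge c=1$, $$\frac{1}{2\left(\frac1{\Delta x}+\frac1{\Delta y}\right)}\sum_{i=1}^L\omega_i\bigg[\frac1{\Delta x}\Big(\tilde{\mathbf U}^i-\alpha^{-1}\mathbf F_1(\tilde{\mathbf U}^i)+\hat{\mathbf U}^i+\alpha^{-1}\mathbf F_1(\hat{\mathbf U}^i)\Big)+\frac1{\Delta y}\Big(\bar{\mathbf U}^i-\alpha^{-1}\mathbf F_2(\bar{\mathbf U}^i)+\breve{\mathbf U}^i+\alpha^{-1}\mathbf F_2(\breve{\mathbf U}^i)\Big)\bigg]\in\mathcal G.$$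
   Context: Fix the adiabatic index $\Gamma\in(1,2]$ (equation of state $p=(\Gamma-1)\rho e$; speed of light $c=1$). For primitive variables $\mathbf V=(\rho,\mathbf v,\mathbf B,p)$ with $\rho,p>0$, $\mathbf v,\mathbf B\in\mathbb R^3$, $|\mathbf v|<1$, put $W=(1-|\mathbf v|^2)^{-1/2}$, $e=\frac{p}{(\Gamma-1)\rho}$, $h=1+e+\frac p\rho$, $p_m=\frac12\big(W^{-2}|\mathbf B|^2+(\mathbf v\cdot\mathbf B)^2\big)$, $p_{tot}=p+p_m$. The associated conservative vector is $\mathbf U(\mathbf V)=(D,\mathbf m,\mathbf B,E)^\top\in\mathbb R^8$ with $D=\rho W$, $\mathbf m=\rho hW^2\mathbf v+|\mathbf B|^2\mathbf v-(\mathbf v\cdot\mathbf B)\mathbf B$, $E=\rho hW^2-p_{tot}+|\mathbf B|^2$. The admissible state set is $\mathcal G=\{\mathbf U(\mathbf V): \rho>0,\ p>0,\ |\mathbf v|<1,\ \mathbf B\in\mathbb R^3\}$. Each $\mathbf U\in\mathcal G$ determines its primitive variables, and for $\mathbf U\in\mathcal G$ and $k\in\{1,2,3\}$ the flux is $$\mathbf F_k(\mathbf U)=\Big(Dv_k,\ v_k\mathbf m-B_k\big(W^{-2}\mathbf B+(\mathbf v\cdot\mathbf B)\mathbf v\big)+p_{tot}\mathbf e_k,\ v_k\mathbf B-B_k\mathbf v,\ m_k\Big)^\top,$$ with $\mathbf e_k$ the $k$-th row of the $3\times3$ identity matrix. $\tilde B_k^i$ denotes the $k$-th component of the magnetic field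 of $\tilde{\mathbf U}^i$, and similarly for the other accents. *)

theory Defs
  imports "HOL-Analysis.Analysis"
begin

text \<open>
  Ideal relativistic magnetohydrodynamics. Primitive states are tuples
  \<open>(\<rho>, v, B, p)\<close>, conservative states are tuples \<open>(D, m, B, E)\<close>; the latter form
  the real vector space \<open>\<real> \<times> \<real>\<^sup>3 \<times> \<real>\<^sup>3 \<times> \<real>\<close> of dimension 8. The speed of light is 1 and
  \<open>\<Gamma>\<close> is the adiabatic index.
\<close>

type_synonym prim_state = "real \<times> (real ^ 3) \<times> (real ^ 3) \<times> real"
type_synonym cons_state = "real \<times> (real ^ 3) \<times> (real ^ 3) \<times> real"

definition lorentz :: "real ^ 3 \<Rightarrow> real" where
  "lorentz v = 1 / sqrt (1 - (norm v)\<^sup>2)"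

definition internal_energy :: "real \<Rightarrow> real \<Rightarrow> real \<Rightarrow> real" where
  "internal_energy \<Gamma> \<rho> p = p / ((\<Gamma> - 1) * \<rho>)"

definition enthalpy :: "real \<Rightarrow> real \<Rightarrow> real \<Rightarrow> real" where
  "enthalpy \<Gamma> \<rho> p = 1 + internal_energy \<Gamma> \<rho> p + p / \<rho>"

definition mag_pressure :: "real ^ 3 \<Rightarrow> real ^ 3 \<Rightarrow> real" where
  "mag_pressure v B = (1 / 2) * ((norm B)\<^sup>2 / (lorentz v)\<^sup>2 + (v \<bullet> B)\<^sup>2)"

definition total_pressure :: "real ^ 3 \<Rightarrow> real ^ 3 \<Rightarrow> real \<Rightarrow> real" where
  "total_pressure v B p = p + mag_pressure v B"

definition prim_states :: "prim_state set" where
  "prim_states = {(\<rho>, v, B, p). 0 < \<rho> \<and> 0 < p \<and> norm v < 1}"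

definition cons_of_prim :: "real \<Rightarrow> prim_state \<Rightarrow> cons_state" where
  "cons_of_prim \<Gamma> = (\<lambda>(\<rho>, v, B, p).
     (\<rho> * lorentz v,
      (\<rho> * enthalpy \<Gamma> \<rho> p * (lorentz v)\<^sup>2) *\<^sub>R v + (norm B)\<^sup>2 *\<^sub>R v - (v \<bullet> B) *\<^sub>R B,
      B,
      \<rho> * enthalpy \<Gamma> \<rho> p * (lorentz v)\<^sup>2 - total_pressure v B p + (norm B)\<^sup>2))"

definition admissible :: "real \<Rightarrow> cons_state set" where
  "admissible \<Gamma> = cons_of_prim \<Gamma> ` prim_states"

text \<open>
  For \<open>1 < \<Gamma> \<le> 2\<close> the map \<open>cons_of_prim \<Gamma>\<close> is injective on \<open>prim_states\<close>, and the
  primitive variables of a conservative state are given by its inverse. The inverse, and with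
  it the flux below, is meaningful on \<open>admissible \<Gamma>\<close> only.
\<close>

definition prim_of_cons :: "real \<Rightarrow> cons_state \<Rightarrow> prim_state" where
  "prim_of_cons \<Gamma> = inv_into prim_states (cons_of_prim \<Gamma>)"

definition mag_field :: "cons_state \<Rightarrow> real ^ 3" where
  "mag_field = (\<lambda>(D, m, B, E). B)"

definition flux :: "real \<Rightarrow> 3 \<Rightarrow> cons_state \<Rightarrow> cons_state" where
  "flux \<Gamma> k U =
     (case U of (D, m, _, E) \<Rightarrow> case prim_of_cons \<Gamma> U of (\<rho>, v, B, p) \<Rightarrow>
       (D * v $ k,
        (v $ k) *\<^sub>R m - (B $ k) *\<^sub>R ((1 / (lorentz v)\<^sup>2) *\<^sub>R B + (v \<bullet> B) *\<^sub>R v)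
          + total_pressure v B p *\<^sub>R axis k 1,
        (v $ k) *\<^sub>R B - (B $ k) *\<^sub>R v,
        m $ k))"

end

theory Submission
  imports Defs
begin

text \<open>
  The admissible set is an intersection of half-spaces. For a velocity \<open>w\<close> with \<open>norm w < 1\<close> and
  a magnetic field \<open>Bs\<close>, the equation \<open>U \<bullet> test_vector w Bs + mag_pressure w Bs = 0\<close> is a
  hyperplane that contains the pressureless states of velocity \<open>w\<close> and field \<open>Bs\<close>. A state of
  positive density that lies strictly above all these hyperplanes is admissible
  (\<open>admissible_if_dual_positive\<close>): the unknown \<open>H = \<rho> h W\<^sup>2\<close> determines velocity and pressure, the
  pressure vanishes at a certain \<open>H\<^sub>0\<close>, and the inequality for the velocity at \<open>H\<^sub>0\<close> gives the
  residual of the energy equation there its sign, so that the intermediate value theorem gives a root with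
  \<open>H > H\<^sub>0\<close>, that is, with positive pressure.

  The half-spaces are described by inequalities that are linear in \<open>U\<close>, hence they can be
  averaged. For a single state, \<open>U + \<theta> F\<^sub>k(U)\<close> with \<open>\<bar>\<theta>\<bar> \<le> 1\<close> satisfies the inequality only up to the
  defect \<open>\<theta> w\<^sub>k mag_pressure w Bs - \<theta> B\<^sub>k (w \<bullet> Bs)\<close> (\<open>lax_friedrichs\<close>). In the average,
  the first part of the defect cancels between opposite faces, because \<open>\<theta> = -1/\<alpha>\<close> on one and
  \<open>\<theta> = 1/\<alpha>\<close> on the other; the second part adds up to a multiple of the discrete divergence of the
  magnetic field, which is zero.

  The inequality for one state is affine in \<open>\<theta>\<close>, so \<open>\<theta> = 1\<close> in a direction \<open>n\<close> with \<open>norm n = 1\<close>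
  is enough. It splits into a hydrodynamic part, positive by the reversed Cauchy-Schwarz
  inequality for four-velocities and by \<open>\<Gamma> \<le> 2\<close>, and a magnetic part, quadratic in \<open>Bs\<close>, whose
  minimum over \<open>Bs\<close> is a nonnegative multiple of the square of the triple product of
  \<open>w - v\<close>, \<open>n + v\<close> and \<open>B\<close> (\<open>magnetic_part_nonneg\<close>).
\<close>

section \<open>Gram determinants in three dimensions\<close>

definition gram_det3 :: "'a::real_inner \<Rightarrow> 'a \<Rightarrow> 'a \<Rightarrow> real" where
  "gram_det3 a b c = (a \<bullet> a) * (b \<bullet> b) * (c \<bullet> c) + 2 * (a \<bullet> b) * (b \<bullet> c) * (a \<bullet> c)
    - (a \<bullet> a) * (b \<bullet> c)\<^sup>2 - (b \<bullet> b) * (a \<bullet> c)\<^sup>2 - (c \<bullet> c) * (a \<bullet> b)\<^sup>2"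

lemma gram_det3_eq_triple_product_sq:
  fixes a b c :: "real ^ 3"
  shows "gram_det3 a b c = (a \<bullet> cross3 b c)\<^sup>2"
  unfolding gram_det3_def inner_vec_def sum_3 inner_real_def cross_components by algebra

text \<open>
  Four vectors of three-dimensional space are dependent, so their Gram determinant vanishes. The
  equation is the expansion of that determinant along the row and the column of \<open>n\<close>.
\<close>

lemma gram_det4_expansion_eq_zero:
  fixes a b c n :: "real ^ 3"
  shows "gram_det3 a b c * (n \<bullet> n) =
      (n \<bullet> a)\<^sup>2 * ((b \<bullet> b) * (c \<bullet> c) - (b \<bullet> c)\<^sup>2)
    + (n \<bullet> b)\<^sup>2 * ((a \<bullet> a) * (c \<bullet> c) - (a \<bullet> c)\<^sup>2)
    + (n \<bullet> c)\<^sup>2 * ((a \<bullet> a) * (b \<bullet> b) - (a \<bullet> b)\<^sup>2)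
    + 2 * (n \<bullet> a) * (n \<bullet> b) * ((b \<bullet> c) * (a \<bullet> c) - (a \<bullet> b) * (c \<bullet> c))
    + 2 * (n \<bullet> b) * (n \<bullet> c) * ((a \<bullet> b) * (a \<bullet> c) - (b \<bullet> c) * (a \<bullet> a))
    + 2 * (n \<bullet> a) * (n \<bullet> c) * ((a \<bullet> b) * (b \<bullet> c) - (a \<bullet> c) * (b \<bullet> b))"
proof -
  \<comment> \<open>The expansion of \<open>n\<close> in the dual basis of \<open>a\<close>, \<open>b\<close>, \<open>c\<close>, cleared of the denominator.\<close>
  have "(a \<bullet> cross3 b c) *\<^sub>R n =
      (n \<bullet> a) *\<^sub>R cross3 b c + (n \<bullet> b) *\<^sub>R cross3 c a + (n \<bullet> c) *\<^sub>R cross3 a b" (is "?l = ?r")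
    by (simp add: vec_eq_iff forall_3 inner_vec_def sum_3 cross3_def algebra_simps)
  then have "?l \<bullet> ?l = ?r \<bullet> ?r" by simp
  moreover have "?l \<bullet> ?l = gram_det3 a b c * (n \<bullet> n)"
    by (simp add: gram_det3_eq_triple_product_sq power2_eq_square)
  ultimately have "gram_det3 a b c * (n \<bullet> n) = ?r \<bullet> ?r" by simp
  then show ?thesis
    unfolding inner_add_left inner_add_right inner_scaleR_left inner_scaleR_right dot_cross
      inner_commute[of b a] inner_commute[of c a] inner_commute[of c b]
    by algebra
qed

section \<open>Inequalities for subluminal velocities\<close>

lemma inner_less_of_square_le:
  fixes w u :: "'a::real_inner"
  assumes "norm w < 1" "0 < c" "u \<bullet> u \<le> c\<^sup>2"
  shows "w \<bullet> u < c"
proof -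
  have "norm u \<le> c"
    using assms by (simp add: norm_eq_sqrt_inner real_le_lsqrt)
  have "w \<bullet> u \<le> norm w * norm u" by (rule norm_cauchy_schwarz)
  also have "\<dots> \<le> norm w * c" using \<open>norm u \<le> c\<close> by (simp add: mult_left_mono)
  also have "\<dots> < c" using assms by simp
  finally show ?thesis .
qed

lemma one_plus_inner_pos:
  fixes n v :: "'a::real_inner"
  assumes "norm n = 1" "norm v < 1"
  shows "0 < 1 + n \<bullet> v"
proof -
  have "\<bar>n \<bullet> v\<bar> \<le> norm n * norm v" by (rule Cauchy_Schwarz_ineq2)
  then show ?thesis using assms by auto
qed

text \<open>
  Multiplied by the Lorentz factor of \<open>w\<close> and the squared Lorentz factor of \<open>v\<close>, both sides
  become invariant under Lorentz boosts. Since the difference of the two sides is affine in \<open>w\<close>,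
  it is positive as soon as the vector that is paired with \<open>w\<close> is not longer than the constant term;
  because \<open>(1, -n)\<close> is a null vector, the two lengths agree.
\<close>

lemma pressure_flux_dominated:
  fixes n v w :: "'a::real_inner"
  assumes n: "norm n = 1" and v: "norm v < 1" and w: "norm w < 1"
  shows "(1 - v \<bullet> v) * (1 + n \<bullet> w) < 2 * (1 - v \<bullet> w) * (1 + n \<bullet> v)"
proof -
  define a where "a = 1 + n \<bullet> v"
  define k where "k = 1 - v \<bullet> v"
  have nn: "n \<bullet> n = 1" using n by (simp add: norm_eq_1)
  have "\<bar>n \<bullet> v\<bar> \<le> norm n * norm v" by (rule Cauchy_Schwarz_ineq2)
  then have "1 - norm v \<le> a" using n by (simp add: a_def)
  moreover have "k = (1 - norm v) * (1 + norm v)"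
    by (simp add: k_def power2_norm_eq_inner[symmetric] power2_eq_square algebra_simps)
  moreover have "(1 - norm v) * (1 + norm v) < (1 - norm v) * 2"
    using v by (intro mult_strict_left_mono) auto
  ultimately have pos: "0 < 2 * a - k" by (smt (verit))
  have "((2 * a) *\<^sub>R v + k *\<^sub>R n) \<bullet> ((2 * a) *\<^sub>R v + k *\<^sub>R n) = (2 * a - k)\<^sup>2"
    unfolding inner_add_left inner_add_right inner_scaleR_left inner_scaleR_right inner_commute[of v n] nn
    using a_def k_def by algebra
  then have "w \<bullet> ((2 * a) *\<^sub>R v + k *\<^sub>R n) < 2 * a - k"
    by (intro inner_less_of_square_le w pos) simp
  then show ?thesis
    by (simp add: inner_add_right inner_commute[of w] a_def k_def algebra_simps)
qed

text \<open>
  The relative Lorentz factor of two velocities is at least 1.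
\<close>

lemma reversed_cauchy_schwarz:
  fixes v w :: "'a::real_inner"
  assumes v: "norm v < 1" and w: "norm w < 1"
  shows "sqrt (1 - v \<bullet> v) * sqrt (1 - w \<bullet> w) \<le> 1 - v \<bullet> w"
proof -
  have le: "v \<bullet> w \<le> norm v * norm w" by (rule norm_cauchy_schwarz)
  have "norm v * norm w \<le> 1 * 1" using v w by (intro mult_mono) auto
  then have pos: "0 \<le> 1 - norm v * norm w" by simp
  have "(1 - v \<bullet> v) * (1 - w \<bullet> w) \<le> (1 - norm v * norm w)\<^sup>2"
    using zero_le_power2[of "norm v - norm w"]
    by (simp add: power2_norm_eq_inner[symmetric] power2_eq_square algebra_simps)
  then have "sqrt ((1 - v \<bullet> v) * (1 - w \<bullet> w)) \<le> 1 - norm v * norm w"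
    using pos by (rule real_le_lsqrt[rotated])
  then show ?thesis using le by (simp add: real_sqrt_mult)
qed

section \<open>The half-space inequality for a single state\<close>

text \<open>
  The magnetic contribution to the half-space inequality. With \<open>s = 1 + w \<bullet> n\<close> and the
  positive semidefinite form \<open>Q X = (1 - w \<bullet> w) * (X \<bullet> X) + (w \<bullet> X)\<^sup>2\<close>, twice \<open>s\<close> times the
  expression is \<open>Q (s *\<^sub>R Bs - C)\<close> plus its value at the minimiser \<open>Bs = C / s\<close>. For \<open>w = 0\<close> this
  value is the Gram determinant of \<open>v\<close>, \<open>n\<close> and \<open>B\<close>. The general value is what it becomes under a
  boost: the square of the determinant of the four-vectors \<open>(1, v)\<close>, \<open>(1, w)\<close>, \<open>(1, -n)\<close> and
  \<open>(0, B)\<close>. Subtracting \<open>(1, v)\<close> from the second and the third of them leaves, up to sign, the triple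
  product of \<open>w - v\<close>, \<open>n + v\<close> and \<open>B\<close>.
\<close>

lemma magnetic_part_nonneg:
  fixes n v w B Bs :: "real ^ 3"
  assumes n: "norm n = 1" and w: "norm w < 1"
  defines "pm \<equiv> ((1 - v \<bullet> v) * (B \<bullet> B) + (v \<bullet> B)\<^sup>2) / 2"
    and "C \<equiv> (1 + v \<bullet> n) *\<^sub>R B - (B \<bullet> n) *\<^sub>R (v - w)"
  shows "0 \<le> (1 + v \<bullet> n) * (B \<bullet> B) - (v \<bullet> B) * (B \<bullet> n)
      - (1 + v \<bullet> n) * ((B \<bullet> B) * (v \<bullet> w) - (v \<bullet> B) * (B \<bullet> w))
      + (B \<bullet> n) * ((1 - v \<bullet> v) * (B \<bullet> w) + (v \<bullet> B) * (v \<bullet> w))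
      - (1 + w \<bullet> n) * pm
      - ((1 - w \<bullet> w) * (C \<bullet> Bs) + (w \<bullet> C) * (w \<bullet> Bs))
      + (1 + w \<bullet> n) * (((1 - w \<bullet> w) * (Bs \<bullet> Bs) + (w \<bullet> Bs)\<^sup>2) / 2)"
    (is "0 \<le> ?M")
proof -
  define s where "s = 1 + w \<bullet> n"
  define X where "X = s *\<^sub>R Bs - C"
  let ?a = "w - v" and ?b = "n + v"
  have s: "0 < s"
    unfolding s_def inner_commute[of w] using n w by (rule one_plus_inner_pos)
  have nn: "n \<bullet> n = 1" using n by (simp add: norm_eq_1)
  note comm = inner_commute[of w v] inner_commute[of n v] inner_commute[of n w]
    inner_commute[of B v] inner_commute[of B w] inner_commute[of n B]
    inner_commute[of B Bs] inner_commute[of v Bs] inner_commute[of w Bs]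
  \<comment> \<open>Twice \<open>s\<close> times the expression agrees with the sum of the Gram determinant and \<open>Q\<close> up to the
    Gram determinant \<open>gram_det3 v w B - R\<close> of \<open>n\<close>, \<open>v\<close>, \<open>w\<close>, \<open>B\<close>.\<close>
  define R where "R = (v \<bullet> n)\<^sup>2 * ((w \<bullet> w) * (B \<bullet> B) - (w \<bullet> B)\<^sup>2)
    + (w \<bullet> n)\<^sup>2 * ((v \<bullet> v) * (B \<bullet> B) - (v \<bullet> B)\<^sup>2)
    + (B \<bullet> n)\<^sup>2 * ((v \<bullet> v) * (w \<bullet> w) - (v \<bullet> w)\<^sup>2)
    + 2 * (v \<bullet> n) * (w \<bullet> n) * ((w \<bullet> B) * (v \<bullet> B) - (v \<bullet> w) * (B \<bullet> B))
    + 2 * (w \<bullet> n) * (B \<bullet> n) * ((v \<bullet> w) * (v \<bullet> B) - (w \<bullet> B) * (v \<bullet> v))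
    + 2 * (v \<bullet> n) * (B \<bullet> n) * ((v \<bullet> w) * (w \<bullet> B) - (v \<bullet> B) * (w \<bullet> w))"
  have rel: "gram_det3 v w B = R"
    using gram_det4_expansion_eq_zero[of v w B n] by (simp only: nn comm R_def mult_1_right)
  have "2 * s * ?M = gram_det3 ?a ?b B + ((1 - w \<bullet> w) * (X \<bullet> X) + (w \<bullet> X)\<^sup>2) - (gram_det3 v w B - R)"
    unfolding gram_det3_def X_def s_def C_def pm_def R_def
    apply (simp only: inner_add_left inner_add_right inner_diff_left inner_diff_right
      inner_scaleR_left inner_scaleR_right comm nn)
    by (simp add: field_simps power2_eq_square)
  then have id: "2 * s * ?M = gram_det3 ?a ?b B + ((1 - w \<bullet> w) * (X \<bullet> X) + (w \<bullet> X)\<^sup>2)"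
    unfolding rel by simp
  have "0 \<le> gram_det3 ?a ?b B" by (simp add: gram_det3_eq_triple_product_sq)
  moreover have "w \<bullet> w \<le> 1"
    using w by (simp add: power2_norm_eq_inner[symmetric] power_le_one)
  ultimately have "0 \<le> 2 * s * ?M" unfolding id by simp
  then show ?thesis using s by (simp add: zero_le_mult_iff)
qed

lemma lorentz_sq:
  assumes "norm v < 1"
  shows "(lorentz v)\<^sup>2 = 1 / (1 - v \<bullet> v)" "0 < lorentz v" "0 < 1 - v \<bullet> v"
proof -
  have "(norm v)\<^sup>2 < 1" using assms by (simp add: abs_square_less_1)
  then show "0 < 1 - v \<bullet> v" by (simp add: power2_norm_eq_inner)
  with \<open>(norm v)\<^sup>2 < 1\<close> show "(lorentz v)\<^sup>2 = 1 / (1 - v \<bullet> v)" "0 < lorentz v"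
    by (simp_all add: lorentz_def power_divide power2_norm_eq_inner)
qed

lemma mag_pressure_eq:
  assumes "norm v < 1"
  shows "mag_pressure v B = ((1 - v \<bullet> v) * (B \<bullet> B) + (v \<bullet> B)\<^sup>2) / 2"
  using lorentz_sq[OF assms]
  by (simp add: mag_pressure_def power2_norm_eq_inner mult.commute)

text \<open>
  A normal vector, pointing towards larger energies, of a hyperplane that touches the boundary of
  the admissible set: if \<open>U\<close> is the conservative state of zero pressure with velocity \<open>w\<close>,
  field \<open>Bs\<close> and any density, then \<open>U \<bullet> test_vector w Bs = - mag_pressure w Bs\<close>.
\<close>

definition test_vector :: "real ^ 3 \<Rightarrow> real ^ 3 \<Rightarrow> cons_state" where
  "test_vector w Bs =
     (- sqrt (1 - w \<bullet> w), - w, - ((1 - w \<bullet> w) *\<^sub>R Bs + (w \<bullet> Bs) *\<^sub>R w), 1)"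

text \<open>
  The flux through a face with normal \<open>n\<close>, as a function of the primitive state. Allowing
  all directions makes the flux odd in \<open>n\<close>, so that one inequality covers both signs of the flux.
\<close>

definition directional_flux :: "real \<Rightarrow> real ^ 3 \<Rightarrow> prim_state \<Rightarrow> cons_state" where
  "directional_flux \<Gamma> n V =
     (case V of (\<rho>, v, B, p) \<Rightarrow> case cons_of_prim \<Gamma> V of (D, m, _, E) \<Rightarrow>
       (D * (v \<bullet> n),
        (v \<bullet> n) *\<^sub>R m - (B \<bullet> n) *\<^sub>R ((1 / (lorentz v)\<^sup>2) *\<^sub>R B + (v \<bullet> B) *\<^sub>R v)
          + total_pressure v B p *\<^sub>R n,
        (v \<bullet> n) *\<^sub>R B - (B \<bullet> n) *\<^sub>R v,
        m \<bullet> n))"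

lemma directional_flux_minus: "directional_flux \<Gamma> (- n) V = - directional_flux \<Gamma> n V"
  by (simp add: directional_flux_def split: prod.split)

text \<open>
  On the admissible set, \<open>prim_of_cons\<close> is a right inverse of \<open>cons_of_prim\<close>, so the primitive state
  that it selects serves as \<open>V\<close>.
\<close>

lemma flux_eq_directional_flux:
  assumes "U \<in> admissible \<Gamma>"
  obtains V where "V \<in> prim_states" "cons_of_prim \<Gamma> V = U"
    "flux \<Gamma> k U = directional_flux \<Gamma> (axis k 1) V"
proof
  have U: "U \<in> cons_of_prim \<Gamma> ` prim_states" using assms by (simp add: admissible_def)
  show "prim_of_cons \<Gamma> U \<in> prim_states"
    unfolding prim_of_cons_def using U by (rule inv_into_into)
  show *: "cons_of_prim \<Gamma> (prim_of_cons \<Gamma> U) = U"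
    unfolding prim_of_cons_def using U by (rule f_inv_into_f)
  obtain \<rho> v B p where V: "prim_of_cons \<Gamma> U = (\<rho>, v, B, p)" by (cases "prim_of_cons \<Gamma> U")
  have B: "\<exists>D m E. U = (D, m, B, E)"
    using * by (auto simp: V cons_of_prim_def)
  then show "flux \<Gamma> k U = directional_flux \<Gamma> (axis k 1) (prim_of_cons \<Gamma> U)"
    using * by (auto simp: V flux_def directional_flux_def inner_axis)
qed

text \<open>
  The terms without \<open>B\<close> and \<open>Bs\<close> form the hydrodynamic part, the others the magnetic part. Strictness
  comes from the pressure in the former; the magnetic part can vanish.
\<close>

lemma lax_friedrichs_unit:
  assumes \<Gamma>: "1 < \<Gamma>" "\<Gamma> \<le> 2" and V: "V \<in> prim_states" and n: "norm n = 1" and w: "norm w < 1"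
  defines "U \<equiv> cons_of_prim \<Gamma> V"
  shows "0 < (U + directional_flux \<Gamma> n V) \<bullet> test_vector w Bs
    + (1 + w \<bullet> n) * mag_pressure w Bs - (mag_field U \<bullet> n) * (w \<bullet> Bs)"
proof -
  obtain \<rho> v B p where Veq: "V = (\<rho>, v, B, p)" by (cases V)
  have \<rho>: "0 < \<rho>" and p: "0 < p" and v: "norm v < 1"
    using V by (auto simp: Veq prim_states_def)
  define k where "k = 1 - v \<bullet> v"
  define H where "H = \<rho> * enthalpy \<Gamma> \<rho> p * (lorentz v)\<^sup>2"
  define D where "D = \<rho> * lorentz v"
  define C where "C = (1 + v \<bullet> n) *\<^sub>R B - (B \<bullet> n) *\<^sub>R (v - w)"
  have k: "0 < k" "(lorentz v)\<^sup>2 = 1 / k" "0 < lorentz v"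
    using lorentz_sq[OF v] by (simp_all add: k_def)
  have s: "0 < 1 + w \<bullet> n" and a: "0 < 1 + v \<bullet> n"
    using one_plus_inner_pos[OF n w] one_plus_inner_pos[OF n v] by (simp_all add: inner_commute)
  have vw: "0 < 1 - v \<bullet> w"
  proof -
    have "v \<bullet> w \<le> norm v * norm w" by (rule norm_cauchy_schwarz)
    moreover have "norm v * norm w < 1 * 1" using v w by (intro mult_strict_mono') auto
    ultimately show ?thesis by simp
  qed
  have hydro: "0 < (1 + v \<bullet> n) * (H * (1 - v \<bullet> w) - D * sqrt (1 - w \<bullet> w)) - (1 + w \<bullet> n) * p"
  proof -
    \<comment> \<open>The bound \<open>\<Gamma> \<le> 2\<close> enters through \<open>\<Gamma> / (\<Gamma> - 1) \<ge> 2\<close>, which matches the factor 2 in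
      \<open>pressure_flux_dominated\<close>.\<close>
    have "2 * p \<le> \<Gamma> / (\<Gamma> - 1) * p"
      using \<Gamma> p by (intro mult_right_mono) (auto simp: field_simps)
    moreover have "\<rho> * enthalpy \<Gamma> \<rho> p = \<rho> + \<Gamma> / (\<Gamma> - 1) * p"
      using \<Gamma> \<rho> by (simp add: enthalpy_def internal_energy_def field_simps)
    ultimately have "(\<rho> + 2 * p) / k \<le> H"
      using k by (simp add: H_def divide_right_mono)
    then have "(\<rho> + 2 * p) / k * (1 - v \<bullet> w) \<le> H * (1 - v \<bullet> w)"
      by (rule mult_right_mono) (use vw in simp)
    moreover have "D * sqrt (1 - w \<bullet> w) \<le> \<rho> / k * (1 - v \<bullet> w)"
    proof -
      have "D = \<rho> / k * sqrt k"
        using k by (simp add: D_def lorentz_def k_def power2_norm_eq_inner real_div_sqrt field_simps)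
      then have "D * sqrt (1 - w \<bullet> w) = \<rho> / k * (sqrt k * sqrt (1 - w \<bullet> w))" by simp
      also have "\<dots> \<le> \<rho> / k * (1 - v \<bullet> w)"
        using reversed_cauchy_schwarz[OF v w] \<rho> k by (intro mult_left_mono) (auto simp: k_def)
      finally show ?thesis .
    qed
    ultimately have "2 * p / k * (1 - v \<bullet> w) \<le> H * (1 - v \<bullet> w) - D * sqrt (1 - w \<bullet> w)"
      by (simp add: add_divide_distrib algebra_simps)
    then have "(1 + v \<bullet> n) * (2 * p / k * (1 - v \<bullet> w))
        \<le> (1 + v \<bullet> n) * (H * (1 - v \<bullet> w) - D * sqrt (1 - w \<bullet> w))"
      using a by (intro mult_left_mono) auto
    moreover have "(1 + w \<bullet> n) * p < (1 + v \<bullet> n) * (2 * p / k * (1 - v \<bullet> w))"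
    proof -
      have "k * (1 + w \<bullet> n) * (p / k) < 2 * (1 - v \<bullet> w) * (1 + v \<bullet> n) * (p / k)"
        using pressure_flux_dominated[OF n v w] p k
        by (intro mult_strict_right_mono) (auto simp: k_def inner_commute)
      then show ?thesis using k by (simp add: mult.commute mult.left_commute)
    qed
    ultimately show ?thesis by linarith
  qed
  have pm: "mag_pressure v B = ((1 - v \<bullet> v) * (B \<bullet> B) + (v \<bullet> B)\<^sup>2) / 2"
    "mag_pressure w Bs = ((1 - w \<bullet> w) * (Bs \<bullet> Bs) + (w \<bullet> Bs)\<^sup>2) / 2"
    using v w by (simp_all add: mag_pressure_eq)
  have W2: "1 / (lorentz v)\<^sup>2 = 1 - v \<bullet> v" using k by (simp add: k_def)
  have U: "U = (D, H *\<^sub>R v + (B \<bullet> B) *\<^sub>R v - (v \<bullet> B) *\<^sub>R B, B, H - (p + mag_pressure v B) + B \<bullet> B)"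
    by (simp add: U_def Veq cons_of_prim_def D_def H_def total_pressure_def power2_norm_eq_inner)
  have F: "directional_flux \<Gamma> n V = (D * (v \<bullet> n),
      (v \<bullet> n) *\<^sub>R (H *\<^sub>R v + (B \<bullet> B) *\<^sub>R v - (v \<bullet> B) *\<^sub>R B)
        - (B \<bullet> n) *\<^sub>R ((1 - v \<bullet> v) *\<^sub>R B + (v \<bullet> B) *\<^sub>R v) + (p + mag_pressure v B) *\<^sub>R n,
      (v \<bullet> n) *\<^sub>R B - (B \<bullet> n) *\<^sub>R v,
      (H *\<^sub>R v + (B \<bullet> B) *\<^sub>R v - (v \<bullet> B) *\<^sub>R B) \<bullet> n)"
    using U unfolding U_def by (simp add: directional_flux_def Veq W2 total_pressure_def)
  note comm = inner_commute[of w v] inner_commute[of n v] inner_commute[of n w]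
    inner_commute[of B v] inner_commute[of B w] inner_commute[of n B]
    inner_commute[of B Bs] inner_commute[of v Bs] inner_commute[of w Bs]
  have "(U + directional_flux \<Gamma> n V) \<bullet> test_vector w Bs
      + (1 + w \<bullet> n) * mag_pressure w Bs - (mag_field U \<bullet> n) * (w \<bullet> Bs)
    = ((1 + v \<bullet> n) * (H * (1 - v \<bullet> w) - D * sqrt (1 - w \<bullet> w)) - (1 + w \<bullet> n) * p)
    + ((1 + v \<bullet> n) * (B \<bullet> B) - (v \<bullet> B) * (B \<bullet> n)
      - (1 + v \<bullet> n) * ((B \<bullet> B) * (v \<bullet> w) - (v \<bullet> B) * (B \<bullet> w))
      + (B \<bullet> n) * ((1 - v \<bullet> v) * (B \<bullet> w) + (v \<bullet> B) * (v \<bullet> w))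
      - (1 + w \<bullet> n) * (((1 - v \<bullet> v) * (B \<bullet> B) + (v \<bullet> B)\<^sup>2) / 2)
      - ((1 - w \<bullet> w) * (C \<bullet> Bs) + (w \<bullet> C) * (w \<bullet> Bs))
      + (1 + w \<bullet> n) * (((1 - w \<bullet> w) * (Bs \<bullet> Bs) + (w \<bullet> Bs)\<^sup>2) / 2))"
    unfolding F unfolding U
    apply (simp only: test_vector_def mag_field_def prod.case add_Pair inner_Pair pm C_def
        inner_add_left inner_add_right inner_diff_left inner_diff_right inner_minus_right
        inner_scaleR_left inner_scaleR_right comm inner_real_def)
    by (simp add: field_simps power2_eq_square)
  then show ?thesis
    using add_pos_nonneg[OF hydro magnetic_part_nonneg[OF n w, of v B Bs, folded C_def]] by presburger
qed

text \<open>
  The estimate is affine in \<open>\<theta>\<close>, hence it follows from the cases \<open>\<theta> = 1\<close> and \<open>\<theta> = - 1\<close>, which are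
  those of the directions \<open>axis k 1\<close> and \<open>- axis k 1\<close>.
\<close>

lemma lax_friedrichs:
  assumes \<Gamma>: "1 < \<Gamma>" "\<Gamma> \<le> 2" and U: "U \<in> admissible \<Gamma>" and \<theta>: "\<bar>\<theta>\<bar> \<le> 1" and w: "norm w < 1"
  shows "0 < (U + \<theta> *\<^sub>R flux \<Gamma> k U) \<bullet> test_vector w Bs
    + (1 + \<theta> * w $ k) * mag_pressure w Bs - \<theta> * mag_field U $ k * (w \<bullet> Bs)"
proof -
  obtain V where V: "V \<in> prim_states" "cons_of_prim \<Gamma> V = U"
    and F: "flux \<Gamma> k U = directional_flux \<Gamma> (axis k 1) V"
    using U by (rule flux_eq_directional_flux)
  let ?t = "test_vector w Bs"
  define P where "P \<sigma> = U \<bullet> ?t + mag_pressure w Bs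
    + \<sigma> * (flux \<Gamma> k U \<bullet> ?t + w $ k * mag_pressure w Bs - mag_field U $ k * (w \<bullet> Bs))" for \<sigma>
  have "0 < P 1"
    using lax_friedrichs_unit[OF \<Gamma> V(1) _ w, of "axis k 1" Bs] V(2)
    by (simp add: P_def F inner_axis algebra_simps)
  moreover have "0 < P (- 1)"
    using lax_friedrichs_unit[OF \<Gamma> V(1) _ w, of "- axis k 1" Bs] V(2)
    by (simp add: P_def F directional_flux_minus inner_axis algebra_simps)
  moreover have "P \<theta> = (1 + \<theta>) / 2 * P 1 + (1 - \<theta>) / 2 * P (- 1)"
    by (simp add: P_def field_simps)
  moreover have "0 \<le> 1 + \<theta>" "0 \<le> 1 - \<theta>" using \<theta> by auto
  ultimately have "0 < P \<theta>"
    by (smt (verit, best) divide_nonneg_nonneg divide_pos_pos mult_nonneg_nonneg mult_pos_pos)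
  then show ?thesis by (simp add: P_def algebra_simps)
qed

lemma density_lax_friedrichs_pos:
  assumes U: "U \<in> admissible \<Gamma>" and \<theta>: "\<bar>\<theta>\<bar> \<le> 1"
  shows "0 < fst (U + \<theta> *\<^sub>R flux \<Gamma> k U)"
proof -
  obtain V where V: "V \<in> prim_states" "cons_of_prim \<Gamma> V = U"
    and F: "flux \<Gamma> k U = directional_flux \<Gamma> (axis k 1) V"
    using U by (rule flux_eq_directional_flux)
  obtain \<rho> v B p where Veq: "V = (\<rho>, v, B, p)" by (cases V)
  have \<rho>: "0 < \<rho>" and v: "norm v < 1" using V(1) by (auto simp: Veq prim_states_def)
  have "\<bar>\<theta> * v $ k\<bar> \<le> 1 * \<bar>v $ k\<bar>"
    using \<theta> unfolding abs_mult by (intro mult_right_mono) auto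
  also have "\<dots> < 1" using component_le_norm_cart[of v k] v by simp
  finally have "0 < 1 + \<theta> * v $ k" by linarith
  then have "0 < \<rho> * lorentz v * (1 + \<theta> * v $ k)"
    using \<rho> lorentz_sq(2)[OF v] by simp
  then show ?thesis
    unfolding F using V(2) by (auto simp: Veq cons_of_prim_def directional_flux_def inner_axis algebra_simps)
qed

section \<open>Recovery of the primitive variables\<close>

text \<open>
  The primitive variables are found from the scalar \<open>H = \<rho> h W\<^sup>2\<close>. For given \<open>H > 0\<close>, the
  momentum equation is linear in the velocity and has the solution \<open>v H\<close>, and the density equation
  and the equation of state then give the pressure \<open>p H\<close>; what remains is the energy equation
  \<open>f H = 0\<close>. The squared speed \<open>y\<close> does not increase with \<open>H\<close>, and at the value \<open>H0\<close> with
  \<open>H0\<^sup>2 * (1 - y H0) = D\<^sup>2\<close> the pressure is zero and the velocity subluminal. There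
  \<open>- f H0\<close> is exactly the expression of the assumption with \<open>w = v H0\<close>, so \<open>f\<close> is
  negative at \<open>H0\<close>; for large \<open>H\<close> it is nonnegative since \<open>p H \<le> H / 2\<close> by \<open>\<Gamma> \<le> 2\<close>.
\<close>

lemma admissible_if_dual_positive:
  assumes \<Gamma>: "1 < \<Gamma>" "\<Gamma> \<le> 2" and D: "0 < D"
    and pos: "\<And>w. norm w < 1 \<Longrightarrow> 0 < (D, m, B, E) \<bullet> test_vector w B + mag_pressure w B"
  shows "(D, m, B, E) \<in> admissible \<Gamma>"
proof -
  define b where "b = B \<bullet> B"
  define c where "c = m \<bullet> B"
  define v where "v H = (1 / (H + b)) *\<^sub>R (m + (c / H) *\<^sub>R B)" for H
  define y where "y H = v H \<bullet> v H" for H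
  define p where "p H = (\<Gamma> - 1) / \<Gamma> * (H * (1 - y H) - D * sqrt (1 - y H))" for H
  define f where "f H = H - p H - ((1 - y H) * b + (c / H)\<^sup>2) / 2 + b - E" for H
  have b: "0 \<le> b" by (simp add: b_def)
  have vB: "v H \<bullet> B = c / H" if "0 < H" for H
  proof -
    have "H + b \<noteq> 0" using that b by linarith
    moreover have "(m + (c / H) *\<^sub>R B) \<bullet> B = c / H * (H + b)"
      using that by (simp add: inner_add_left b_def[symmetric] c_def[symmetric] field_simps)
    ultimately show ?thesis by (simp add: v_def)
  qed
  have m: "m = (H + b) *\<^sub>R v H - (v H \<bullet> B) *\<^sub>R B" if "0 < H" for H
  proof -
    have "H + b \<noteq> 0" using that b by linarith
    then show ?thesis unfolding vB[OF that] by (simp add: v_def)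
  qed
  have y: "y H = (m \<bullet> m + 2 * c\<^sup>2 / H + c\<^sup>2 * b / H\<^sup>2) / (H + b)\<^sup>2" if "0 < H" for H
  proof -
    have "(m + (c / H) *\<^sub>R B) \<bullet> (m + (c / H) *\<^sub>R B) = m \<bullet> m + 2 * c\<^sup>2 / H + c\<^sup>2 * b / H\<^sup>2"
      by (simp add: inner_add_left inner_add_right inner_commute[of B m] b_def[symmetric]
          c_def[symmetric] power2_eq_square add_divide_distrib distrib_left)
    then show ?thesis by (simp add: y_def v_def power2_eq_square)
  qed
  have y_nonneg: "0 \<le> y H" for H by (simp add: y_def)
  have y_mono: "y H' \<le> y H" if "0 < H" "H \<le> H'" for H H'
    unfolding y[OF that(1)] y[OF order.strict_trans2[OF that]] using that b
    by (intro frac_le add_mono add_nonneg_nonneg power_mono mult_nonneg_nonneg divide_nonneg_nonneg)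
       auto
  have cont_y: "continuous_on {D..} y"
  proof -
    have "continuous_on {D..} (\<lambda>H. (m \<bullet> m + 2 * c\<^sup>2 / H + c\<^sup>2 * b / H\<^sup>2) / (H + b)\<^sup>2)"
      using D b by (intro continuous_intros) (auto simp: add_nonneg_eq_0_iff)
    then show ?thesis
      by (rule continuous_on_eq) (use D in \<open>auto simp: y\<close>)
  qed
  obtain H0 where H0: "D \<le> H0" "H0\<^sup>2 * (1 - y H0) = D\<^sup>2"
  proof -
    \<comment> \<open>\<open>H\<^sup>2 * y H \<le> N\<close> for \<open>H \<ge> D\<close>, so \<open>K\<close> is chosen to make \<open>K\<^sup>2 - N\<close> equal to \<open>D\<^sup>2\<close>.\<close>
    define N where "N = m \<bullet> m + 2 * c\<^sup>2 / D + c\<^sup>2 * b / D\<^sup>2"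
    define K where "K = sqrt (D\<^sup>2 + N)"
    have N: "0 \<le> N" using D b by (simp add: N_def)
    then have K_sq: "K\<^sup>2 = D\<^sup>2 + N" and DK: "D \<le> K"
      using D by (simp_all add: K_def real_le_rsqrt)
    have K: "0 < K" using D DK by linarith
    have "m \<bullet> m + 2 * c\<^sup>2 / K + c\<^sup>2 * b / K\<^sup>2 \<le> N"
      unfolding N_def using D DK b
      by (intro add_mono frac_le power_mono mult_nonneg_nonneg) auto
    moreover have "K\<^sup>2 \<le> (K + b)\<^sup>2" using K b by (intro power_mono) auto
    ultimately have "y K \<le> N / K\<^sup>2"
      unfolding y[OF K] using K N by (intro frac_le) auto
    then have "K\<^sup>2 * y K \<le> N" using K by (simp add: field_simps)
    then have "D\<^sup>2 \<le> K\<^sup>2 * (1 - y K)" using K_sq by (simp add: algebra_simps)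
    moreover have "D\<^sup>2 * (1 - y D) \<le> D\<^sup>2"
      using y_nonneg[of D] by (simp add: mult_left_le)
    moreover have "continuous_on {D..K} (\<lambda>H. H\<^sup>2 * (1 - y H))"
      by (intro continuous_intros continuous_on_subset[OF cont_y]) auto
    ultimately obtain H where "D \<le> H" "H\<^sup>2 * (1 - y H) = D\<^sup>2"
      using IVT'[of "\<lambda>H. H\<^sup>2 * (1 - y H)" D "D\<^sup>2" K] DK by blast
    then show ?thesis by (rule that)
  qed
  have H0_pos: "0 < H0" using D H0(1) by linarith
  have k0: "1 - y H0 = D\<^sup>2 / H0\<^sup>2" using H0 H0_pos by (simp add: field_simps)
  then have k0_pos: "0 < 1 - y H0" using D H0_pos by simp
  have k_pos: "0 < 1 - y H" if "H0 \<le> H" for H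
    using y_mono[OF H0_pos that] k0_pos by linarith
  have norm_v: "norm (v H) < 1" if "H0 \<le> H" for H
    using k_pos[OF that] by (simp add: y_def power2_norm_eq_inner[symmetric] abs_square_less_1)
  have f_H0: "f H0 < 0"
  proof -
    have sq: "sqrt (1 - y H0) = D / H0" using D H0_pos by (simp add: k0 real_sqrt_divide)
    have Dk: "D * sqrt (1 - y H0) = H0 * (1 - y H0)"
      using H0_pos unfolding sq unfolding k0 by (simp add: power2_eq_square)
    then have p0: "p H0 = 0" by (simp add: p_def)
    define q where "q = (c / H0)\<^sup>2"
    have "m \<bullet> v H0 = ((H0 + b) *\<^sub>R v H0 - (v H0 \<bullet> B) *\<^sub>R B) \<bullet> v H0"
      using m[OF H0_pos] by (rule arg_cong)
    also have "\<dots> = (H0 + b) * y H0 - q"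
      by (simp add: inner_diff_left y_def q_def inner_commute[of B "v H0"] vB[OF H0_pos] power2_eq_square)
    finally have mv: "m \<bullet> v H0 = (H0 + b) * y H0 - q" .
    have tv: "(D, m, B, E) \<bullet> test_vector (v H0) B
        = E - D * sqrt (1 - y H0) - m \<bullet> v H0 - ((1 - y H0) * b + q)"
      by (simp add: test_vector_def inner_add_right inner_diff_right inner_commute[of B "v H0"]
          vB[OF H0_pos] b_def y_def q_def power2_eq_square)
    have mp: "mag_pressure (v H0) B = ((1 - y H0) * b + q) / 2"
      using norm_v[of H0] by (simp add: mag_pressure_eq vB[OF H0_pos] b_def y_def q_def)
    have "(D, m, B, E) \<bullet> test_vector (v H0) B + mag_pressure (v H0) B = - f H0"
      unfolding tv mp mv Dk f_def p0 q_def[symmetric] by (simp add: field_simps)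
    with pos[OF norm_v[of H0]] show ?thesis by simp
  qed
  define H1 where "H1 = max H0 (2 * E)"
  have H1: "H0 \<le> H1" "0 < H1" "2 * E \<le> H1" using H0_pos by (auto simp: H1_def)
  have f_H1: "0 \<le> f H1"
  proof -
    have k1: "0 < 1 - y H1" using k_pos[OF H1(1)] .
    have "H1 * (1 - y H1) - D * sqrt (1 - y H1) \<le> H1 * 1 - 0"
      using H1 k1 D y_nonneg[of H1] by (intro diff_mono mult_left_mono) auto
    then have "p H1 \<le> (\<Gamma> - 1) / \<Gamma> * H1"
      unfolding p_def using \<Gamma> by (intro mult_left_mono) auto
    also have "\<dots> \<le> 1 / 2 * H1"
      using \<Gamma> H1 by (intro mult_right_mono) (auto simp: field_simps)
    finally have "p H1 \<le> H1 / 2" by simp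
    moreover have "(c / H1)\<^sup>2 \<le> y H1 * b"
      using Cauchy_Schwarz_ineq[of "v H1" B] by (simp add: vB[OF H1(2)] y_def b_def)
    moreover have "f H1 = H1 - p H1 + b / 2 + (y H1 * b) / 2 - (c / H1)\<^sup>2 / 2 - E"
      by (simp add: f_def field_simps)
    ultimately show ?thesis using H1 b by linarith
  qed
  have "continuous_on {H0..H1} f"
  proof -
    have "continuous_on {H0..H1} y"
      by (rule continuous_on_subset[OF cont_y]) (use H0 in auto)
    then show ?thesis
      unfolding f_def p_def using H0_pos by (intro continuous_intros) auto
  qed
  then obtain H where H: "H0 \<le> H" "H \<le> H1" "f H = 0"
    using IVT'[of f H0 0 H1] f_H0 f_H1 H1 by auto
  have "H \<noteq> H0" using H f_H0 by auto
  then have H0H: "H0 < H" and H_pos: "0 < H" using H H0_pos by auto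
  note k = k_pos[OF H(1)]
  have nv: "norm (v H) < 1" by (rule norm_v[OF H(1)])
  have p_pos: "0 < p H"
  proof -
    have "D\<^sup>2 = H0\<^sup>2 * (1 - y H0)" using H0 by simp
    also have "\<dots> < H\<^sup>2 * (1 - y H0)"
      using H0H H0_pos k0_pos by (intro mult_strict_right_mono power_strict_mono) auto
    also have "\<dots> \<le> H\<^sup>2 * (1 - y H)"
      using y_mono[OF H0_pos H(1)] by (intro mult_left_mono) auto
    also have "\<dots> = (H * sqrt (1 - y H))\<^sup>2" using k by (simp add: power_mult_distrib)
    finally have sq_less: "D\<^sup>2 < (H * sqrt (1 - y H))\<^sup>2" .
    have "D < H * sqrt (1 - y H)"
      using sq_less by (rule power2_less_imp_less) (use H_pos k in simp)
    have "D * sqrt (1 - y H) < H * sqrt (1 - y H) * sqrt (1 - y H)"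
      by (rule mult_strict_right_mono) (use \<open>D < _\<close> k in simp_all)
    also have "\<dots> = H * (1 - y H)" using k by (simp add: mult.assoc)
    finally show ?thesis using \<Gamma> by (simp add: p_def)
  qed
  define \<rho> where "\<rho> = D * sqrt (1 - y H)"
  have \<rho>: "0 < \<rho>" using D k by (simp add: \<rho>_def)
  have lor: "lorentz (v H) = 1 / sqrt (1 - y H)" by (simp add: lorentz_def y_def power2_norm_eq_inner)
  have "\<rho> * enthalpy \<Gamma> \<rho> (p H) = \<rho> + \<Gamma> / (\<Gamma> - 1) * p H"
    using \<Gamma> \<rho> by (simp add: enthalpy_def internal_energy_def field_simps)
  also have "\<dots> = H * (1 - y H)"
    using \<Gamma> by (simp add: p_def \<rho>_def)
  finally have rhW: "\<rho> * enthalpy \<Gamma> \<rho> (p H) * (lorentz (v H))\<^sup>2 = H"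
    using k by (simp add: lor power_divide)
  have "cons_of_prim \<Gamma> (\<rho>, v H, B, p H) = (D, m, B, E)"
  proof -
    have "\<rho> * lorentz (v H) = D" using k by (simp add: lor \<rho>_def)
    moreover have "H *\<^sub>R v H + (norm B)\<^sup>2 *\<^sub>R v H - (v H \<bullet> B) *\<^sub>R B = m"
      using m[OF H_pos] by (simp add: b_def power2_norm_eq_inner scaleR_add_left)
    moreover have "H - total_pressure (v H) B (p H) + (norm B)\<^sup>2 = E"
      using H(3) by (simp add: f_def total_pressure_def mag_pressure_eq[OF nv] vB[OF H_pos]
          power2_norm_eq_inner b_def y_def)
    ultimately show ?thesis by (simp add: cons_of_prim_def rhW)
  qed
  moreover have "(\<rho>, v H, B, p H) \<in> prim_states"
    using \<rho> p_pos nv by (simp add: prim_states_def)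
  ultimately show ?thesis unfolding admissible_def by (metis imageI)
qed

section \<open>The averaged Lax-Friedrichs state\<close>

theorem theorem2p5:
  fixes \<Gamma> \<Delta>x \<Delta>y \<alpha> :: real
    and L :: nat
    and \<omega> :: "nat \<Rightarrow> real"
    and Utilde Uhat Ubar Ubreve :: "nat \<Rightarrow> cons_state"
  assumes "1 < \<Gamma>" and "\<Gamma> \<le> 2"
    and "0 < \<Delta>x" and "0 < \<Delta>y"
    and "1 \<le> L"
    and "\<And>i. i \<in> {1..L} \<Longrightarrow> 0 < \<omega> i"
    and "(\<Sum>i = 1..L. \<omega> i) = 1"
    and "\<And>i. i \<in> {1..L} \<Longrightarrow> Utilde i \<in> admissible \<Gamma>"
    and "\<And>i. i \<in> {1..L} \<Longrightarrow> Uhat i \<in> admissible \<Gamma>"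
    and "\<And>i. i \<in> {1..L} \<Longrightarrow> Ubar i \<in> admissible \<Gamma>"
    and "\<And>i. i \<in> {1..L} \<Longrightarrow> Ubreve i \<in> admissible \<Gamma>"
    and div_free:
      "(\<Sum>i = 1..L. \<omega> i * (mag_field (Utilde i) $ 1 - mag_field (Uhat i) $ 1)) / \<Delta>x
       + (\<Sum>i = 1..L. \<omega> i * (mag_field (Ubar i) $ 2 - mag_field (Ubreve i) $ 2)) / \<Delta>y = 0"
    and "1 \<le> \<alpha>"
  shows "(1 / (2 * (1 / \<Delta>x + 1 / \<Delta>y))) *\<^sub>R
      (\<Sum>i = 1..L. \<omega> i *\<^sub>R
        ((1 / \<Delta>x) *\<^sub>R (Utilde i - (1 / \<alpha>) *\<^sub>R flux \<Gamma> 1 (Utilde i)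
                      + Uhat i + (1 / \<alpha>) *\<^sub>R flux \<Gamma> 1 (Uhat i))
         + (1 / \<Delta>y) *\<^sub>R (Ubar i - (1 / \<alpha>) *\<^sub>R flux \<Gamma> 2 (Ubar i)
                      + Ubreve i + (1 / \<alpha>) *\<^sub>R flux \<Gamma> 2 (Ubreve i))))
    \<in> admissible \<Gamma>"
proof -
  note \<Gamma> = \<open>1 < \<Gamma>\<close> \<open>\<Gamma> \<le> 2\<close>
  \<comment> \<open>The average is regrouped into Lax-Friedrichs states \<open>U + \<theta> F\<^sub>k(U)\<close> with \<open>\<theta> = - t\<close> or \<open>\<theta> = t\<close>.\<close>
  define t where "t = 1 / \<alpha>"
  have t: "\<bar>- t\<bar> \<le> 1" "\<bar>t\<bar> \<le> 1" using \<open>1 \<le> \<alpha>\<close> by (simp_all add: t_def)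
  define cx cy where "cx = 1 / \<Delta>x" and "cy = 1 / \<Delta>y"
  have c: "0 < cx" "0 < cy" using \<open>0 < \<Delta>x\<close> \<open>0 < \<Delta>y\<close> by (simp_all add: cx_def cy_def)
  define X where "X i =
      cx *\<^sub>R ((Utilde i + (- t) *\<^sub>R flux \<Gamma> 1 (Utilde i)) + (Uhat i + t *\<^sub>R flux \<Gamma> 1 (Uhat i)))
    + cy *\<^sub>R ((Ubar i + (- t) *\<^sub>R flux \<Gamma> 2 (Ubar i)) + (Ubreve i + t *\<^sub>R flux \<Gamma> 2 (Ubreve i)))" for i
  define S where "S = (1 / (2 * (cx + cy))) *\<^sub>R (\<Sum>i = 1..L. \<omega> i *\<^sub>R X i)"
  have nonempty: "{1..L} \<noteq> {}" using \<open>1 \<le> L\<close> by simp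
  have "0 < fst (X i)" if "i \<in> {1..L}" for i
  proof -
    note d = density_lax_friedrichs_pos
    note X_density = d[OF assms(8)[OF that] t(1), of 1] d[OF assms(9)[OF that] t(2), of 1]
      d[OF assms(10)[OF that] t(1), of 2] d[OF assms(11)[OF that] t(2), of 2]
    have "0 < cx * (fst (Utilde i + (- t) *\<^sub>R flux \<Gamma> 1 (Utilde i)) + fst (Uhat i + t *\<^sub>R flux \<Gamma> 1 (Uhat i)))
        + cy * (fst (Ubar i + (- t) *\<^sub>R flux \<Gamma> 2 (Ubar i)) + fst (Ubreve i + t *\<^sub>R flux \<Gamma> 2 (Ubreve i)))"
      by (intro add_pos_pos mult_pos_pos c X_density)
    then show ?thesis by (simp add: X_def)
  qed
  then have "0 < (\<Sum>i = 1..L. fst (\<omega> i *\<^sub>R X i))"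
    using assms(6) nonempty by (intro sum_pos) auto
  then have density: "0 < fst S" using c by (simp add: S_def fst_sum)
  have dual: "0 < S \<bullet> test_vector w Bs + mag_pressure w Bs" if w: "norm w < 1" for w Bs
  proof -
    let ?t = "test_vector w Bs"
    let ?q = "mag_pressure w Bs"
    let ?r = "w \<bullet> Bs"
    \<comment> \<open>The terms \<open>t * w\<^sub>k * mag_pressure w Bs\<close> of opposite faces have cancelled in this bound.\<close>
    define lower where "lower i = cx * (- 2 * ?q - t * ?r * (mag_field (Utilde i) $ 1 - mag_field (Uhat i) $ 1))
      + cy * (- 2 * ?q - t * ?r * (mag_field (Ubar i) $ 2 - mag_field (Ubreve i) $ 2))" for i
    have less: "lower i < X i \<bullet> ?t" if i: "i \<in> {1..L}" for i
    proof -
      have X_split: "X i \<bullet> ?t =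
          cx * ((Utilde i + (- t) *\<^sub>R flux \<Gamma> 1 (Utilde i)) \<bullet> ?t + (Uhat i + t *\<^sub>R flux \<Gamma> 1 (Uhat i)) \<bullet> ?t)
        + cy * ((Ubar i + (- t) *\<^sub>R flux \<Gamma> 2 (Ubar i)) \<bullet> ?t + (Ubreve i + t *\<^sub>R flux \<Gamma> 2 (Ubreve i)) \<bullet> ?t)"
        unfolding X_def inner_add_left inner_scaleR_left by (rule refl)
      note lf = lax_friedrichs[OF \<Gamma> _ _ w, where Bs = Bs]
      have "- 2 * ?q - t * ?r * (mag_field (Utilde i) $ 1 - mag_field (Uhat i) $ 1)
          < (Utilde i + (- t) *\<^sub>R flux \<Gamma> 1 (Utilde i)) \<bullet> ?t + (Uhat i + t *\<^sub>R flux \<Gamma> 1 (Uhat i)) \<bullet> ?t"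
        using lf[OF assms(8)[OF i] t(1), of 1] lf[OF assms(9)[OF i] t(2), of 1]
        by (simp add: algebra_simps)
      moreover have "- 2 * ?q - t * ?r * (mag_field (Ubar i) $ 2 - mag_field (Ubreve i) $ 2)
          < (Ubar i + (- t) *\<^sub>R flux \<Gamma> 2 (Ubar i)) \<bullet> ?t + (Ubreve i + t *\<^sub>R flux \<Gamma> 2 (Ubreve i)) \<bullet> ?t"
        using lf[OF assms(10)[OF i] t(1), of 2] lf[OF assms(11)[OF i] t(2), of 2]
        by (simp add: algebra_simps)
      ultimately show ?thesis
        unfolding X_split lower_def using c by (intro add_strict_mono mult_strict_left_mono)
    qed
    have "(\<Sum>i = 1..L. \<omega> i * lower i) = (\<Sum>i = 1..L. \<omega> i) * (- 2 * ?q * (cx + cy))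
        - t * ?r * ((\<Sum>i = 1..L. \<omega> i * (mag_field (Utilde i) $ 1 - mag_field (Uhat i) $ 1)) / \<Delta>x
         + (\<Sum>i = 1..L. \<omega> i * (mag_field (Ubar i) $ 2 - mag_field (Ubreve i) $ 2)) / \<Delta>y)"
      unfolding sum_distrib_right sum_distrib_left sum_divide_distrib
        sum.distrib[symmetric] sum_subtractf[symmetric]
      by (intro sum.cong) (simp_all add: lower_def cx_def cy_def diff_divide_distrib algebra_simps)
    also have "\<dots> = - (2 * (cx + cy)) * ?q"
      unfolding div_free assms(7) by (simp add: algebra_simps)
    finally have "- (2 * (cx + cy)) * ?q = (\<Sum>i = 1..L. \<omega> i * lower i)" by simp
    also have "\<dots> < (\<Sum>i = 1..L. \<omega> i * (X i \<bullet> ?t))"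
      using nonempty assms(6) less by (intro sum_strict_mono) auto
    also have "\<dots> = 2 * (cx + cy) * (S \<bullet> ?t)"
      using c by (simp add: S_def inner_sum_left)
    finally have "0 < 2 * (cx + cy) * (S \<bullet> ?t + ?q)" by (simp add: algebra_simps)
    then show ?thesis using c by (simp add: zero_less_mult_iff)
  qed
  have "S \<in> admissible \<Gamma>"
    using admissible_if_dual_positive[OF \<Gamma>, of "fst S" "fst (snd S)" "fst (snd (snd S))" "snd (snd (snd S))"]
      density dual by simp
  then show ?thesis
    by (simp add: S_def X_def t_def cx_def cy_def algebra_simps)
qed

end
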